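(* Let $\ddot{\mathbb A}$ be a relational BiKAT over a relational KAT $\mathbb A$ on $\Sigma$ that contains the top element $\mathbf{hav}=\Sigma\times\Sigma$. Let $c,d\in\mathbb A$ and let $R,S$ be relations on $\Sigma$ with $\dot R,\dot S$ tests of $\ddot{\mathbb A}$. If there exists $W\in\ddot{\mathbb A}$ such that (WCb) $W;\dot S\le \dot R;W;\dot S$, (WOb) $\langle c];\dot S\le [\mathbf{hav}\rangle;W$, and (WUb) $W;\dot S\le \langle\mathbf{hav}\mid d\rangle$, then the backward simulation $c\mid d:R\overset{\exists\leftarrow}{\approx>}S$ holds, i.e., $\forall\sigma,\tau,\tau'.\ \sigma\,c\,\tau\wedge\tau S\tau'\Rightarrow\exists\sigma'.\ \sigma R\sigma'\wedge\sigma'\,d\,\tau'$.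
   Context: A relational KAT on a set $\Sigma$: actions are relations on $\Sigma$, tests sub-identities, $1=id_\Sigma$, $0=\emptyset$, $;$ composition, $+$ union, ${}^*$ reflexive-transitive closure, $\neg p=id_\Sigma\setminus p$, $\le$ inclusion. A relational BiKAT over a relational KAT $\mathbb A$ on $\Sigma$ is a relational KAT $\ddot{\mathbb A}$ on $\Sigma\times\Sigma$ containing $\langle R]=R\otimes id_\Sigma$ and $[R\rangle=id_\Sigma\otimes R$ for every $R\in\mathbb A$ (where $(\sigma,\sigma')(R\otimes S)(\tau,\tau')$ iff $\sigma R\tau\wedge\sigma'S\tau'$), and whose left/right projections (existentially quantifying the other component of initial and final state pairs) lie in $\mathbb A$. $\langle c\mid d\rangle=\langle c];[d\rangle=c\otimes d$. For a relation $R$ on $\Sigma$, $\dot R$ is the sub-identity on $\Sigma\times\Sigma$ containing $((\sigma,\sigma'),(\sigma,\sigma'))$ iff $\sigma R\sigma'$. *)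

theory Defs
  imports Main
begin

definition star_on :: "'a set \<Rightarrow> 'a rel \<Rightarrow> 'a rel" where
  "star_on \<Sigma> R = Id_on \<Sigma> \<union> R\<^sup>+"

text \<open>
  The carrier \<open>\<Sigma>\<close> is an arbitrary set; \<open>A\<close> are the actions and \<open>B\<close> the tests.
  Not every sub-identity in \<open>A\<close> need be a test.
\<close>

locale relational_KAT =
  fixes \<Sigma> :: "'a set" and A B :: "'a rel set"
  assumes actions_rel: "R \<in> A \<Longrightarrow> R \<subseteq> \<Sigma> \<times> \<Sigma>"
    and tests_actions: "B \<subseteq> A"
    and tests_subid: "p \<in> B \<Longrightarrow> p \<subseteq> Id_on \<Sigma>"
    and one_test: "Id_on \<Sigma> \<in> B"
    and zero_test: "{} \<in> B"
    and comp_action: "R \<in> A \<Longrightarrow> S \<in> A \<Longrightarrow> R O S \<in> A"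
    and union_action: "R \<in> A \<Longrightarrow> S \<in> A \<Longrightarrow> R \<union> S \<in> A"
    and star_action: "R \<in> A \<Longrightarrow> star_on \<Sigma> R \<in> A"
    and comp_test: "p \<in> B \<Longrightarrow> q \<in> B \<Longrightarrow> p O q \<in> B"
    and union_test: "p \<in> B \<Longrightarrow> q \<in> B \<Longrightarrow> p \<union> q \<in> B"
    and neg_test: "p \<in> B \<Longrightarrow> Id_on \<Sigma> - p \<in> B"

definition rel_tensor :: "'a rel \<Rightarrow> 'a rel \<Rightarrow> ('a \<times> 'a) rel" where
  "rel_tensor R S = {((\<sigma>, \<sigma>'), (\<tau>, \<tau>')) | \<sigma> \<sigma>' \<tau> \<tau>'. (\<sigma>, \<tau>) \<in> R \<and> (\<sigma>', \<tau>') \<in> S}"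

definition embL :: "'a set \<Rightarrow> 'a rel \<Rightarrow> ('a \<times> 'a) rel" where
  "embL \<Sigma> R = rel_tensor R (Id_on \<Sigma>)"

definition embR :: "'a set \<Rightarrow> 'a rel \<Rightarrow> ('a \<times> 'a) rel" where
  "embR \<Sigma> R = rel_tensor (Id_on \<Sigma>) R"

definition bipair :: "'a set \<Rightarrow> 'a rel \<Rightarrow> 'a rel \<Rightarrow> ('a \<times> 'a) rel" where
  "bipair \<Sigma> c d = embL \<Sigma> c O embR \<Sigma> d"

definition projL :: "('a \<times> 'a) rel \<Rightarrow> 'a rel" where
  "projL W = {(\<sigma>, \<tau>). \<exists>\<sigma>' \<tau>'. ((\<sigma>, \<sigma>'), (\<tau>, \<tau>')) \<in> W}"

definition projR :: "('a \<times> 'a) rel \<Rightarrow> 'a rel" where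
  "projR W = {(\<sigma>', \<tau>'). \<exists>\<sigma> \<tau>. ((\<sigma>, \<sigma>'), (\<tau>, \<tau>')) \<in> W}"

locale relational_BiKAT =
  base: relational_KAT \<Sigma> A B + bi: relational_KAT "\<Sigma> \<times> \<Sigma>" AA BB
  for \<Sigma> :: "'a set" and A B :: "'a rel set" and AA BB :: "('a \<times> 'a) rel set" +
  assumes embL_action: "R \<in> A \<Longrightarrow> embL \<Sigma> R \<in> AA"
    and embR_action: "R \<in> A \<Longrightarrow> embR \<Sigma> R \<in> AA"
    and projL_action: "W \<in> AA \<Longrightarrow> projL W \<in> A"
    and projR_action: "W \<in> AA \<Longrightarrow> projR W \<in> A"

definition hav :: "'a set \<Rightarrow> 'a rel" where
  "hav \<Sigma> = \<Sigma> \<times> \<Sigma>"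

definition dot :: "'a rel \<Rightarrow> ('a \<times> 'a) rel" where
  "dot R = {((\<sigma>, \<sigma>'), (\<sigma>, \<sigma>')) | \<sigma> \<sigma>'. (\<sigma>, \<sigma>') \<in> R}"

definition backward_sim ::
    "'a set \<Rightarrow> 'a rel \<Rightarrow> 'a rel \<Rightarrow> 'a rel \<Rightarrow> 'a rel \<Rightarrow> bool" where
  "backward_sim \<Sigma> c d R S \<longleftrightarrow>
    (\<forall>\<sigma>\<in>\<Sigma>. \<forall>\<tau>\<in>\<Sigma>. \<forall>\<tau>'\<in>\<Sigma>. (\<sigma>, \<tau>) \<in> c \<and> (\<tau>, \<tau>') \<in> S \<longrightarrow>
      (\<exists>\<sigma>'\<in>\<Sigma>. (\<sigma>, \<sigma>') \<in> R \<and> (\<sigma>', \<tau>') \<in> d))"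

lemma bipair_eq_tensor:
  assumes "c \<subseteq> \<Sigma> \<times> \<Sigma>" "d \<subseteq> \<Sigma> \<times> \<Sigma>"
  shows "bipair \<Sigma> c d = rel_tensor c d"
  using assms unfolding bipair_def embL_def embR_def rel_tensor_def by fastforce

lemma full_relational_KAT:
  "relational_KAT \<Sigma> (Pow (\<Sigma> \<times> \<Sigma>)) (Pow (Id_on \<Sigma>))"
proof
  fix R assume "R \<in> Pow (\<Sigma> \<times> \<Sigma>)"
  then show "star_on \<Sigma> R \<in> Pow (\<Sigma> \<times> \<Sigma>)"
    unfolding star_on_def using trancl_subset_Sigma[of R \<Sigma>] by auto
qed auto

lemma full_relational_BiKAT:
  "relational_BiKAT \<Sigma> (Pow (\<Sigma> \<times> \<Sigma>)) (Pow (Id_on \<Sigma>))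
    (Pow ((\<Sigma> \<times> \<Sigma>) \<times> (\<Sigma> \<times> \<Sigma>))) (Pow (Id_on (\<Sigma> \<times> \<Sigma>)))"
  unfolding relational_BiKAT_def relational_BiKAT_axioms_def
  using full_relational_KAT[of \<Sigma>] full_relational_KAT[of "\<Sigma> \<times> \<Sigma>"]
  by (auto simp: embL_def embR_def rel_tensor_def projL_def projR_def)

end

theory Submission
  imports Defs
begin

text \<open>
  Given \<open>\<sigma> c \<tau>\<close> and \<open>\<tau> S \<tau>'\<close>, start the right component at \<open>\<tau>'\<close> and let it stand still while
  \<open>c\<close> runs on the left. Condition (WOb) turns this run into a \<open>W\<close>-step from some \<open>(\<sigma>, \<sigma>')\<close> to
  \<open>(\<tau>, \<tau>')\<close>; for this \<open>\<sigma>'\<close>, (WCb) gives \<open>\<sigma> R \<sigma>'\<close> and (WUb) gives \<open>\<sigma>' d \<tau>'\<close>.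
\<close>

theorem theorem7p2:
  fixes \<Sigma> :: "'a set" and A B :: "'a rel set" and AA BB :: "('a \<times> 'a) rel set"
    and c d R S :: "'a rel"
  assumes bikat: "relational_BiKAT \<Sigma> A B AA BB"
    and hav: "hav \<Sigma> \<in> A"
    and c: "c \<in> A" and d: "d \<in> A"
    and R: "R \<subseteq> \<Sigma> \<times> \<Sigma>" and S: "S \<subseteq> \<Sigma> \<times> \<Sigma>"
    and dotR: "dot R \<in> BB" and dotS: "dot S \<in> BB"
    and witness: "\<exists>W\<in>AA. W O dot S \<subseteq> dot R O W O dot S
                       \<and> embL \<Sigma> c O dot S \<subseteq> embR \<Sigma> (hav \<Sigma>) O W
                       \<and> W O dot S \<subseteq> bipair \<Sigma> (hav \<Sigma>) d"
  shows "backward_sim \<Sigma> c d R S"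
proof -
  obtain W where WC: "W O dot S \<subseteq> dot R O W O dot S"
    and WO: "embL \<Sigma> c O dot S \<subseteq> embR \<Sigma> (hav \<Sigma>) O W"
    and WU: "W O dot S \<subseteq> bipair \<Sigma> (hav \<Sigma>) d"
    using witness by blast
  have "\<exists>\<sigma>'\<in>\<Sigma>. (\<sigma>, \<sigma>') \<in> R \<and> (\<sigma>', \<tau>') \<in> d"
    if "(\<sigma>, \<tau>) \<in> c" "(\<tau>, \<tau>') \<in> S" "\<tau>' \<in> \<Sigma>" for \<sigma> \<tau> \<tau>'
  proof -
    have inS: "((\<tau>, \<tau>'), (\<tau>, \<tau>')) \<in> dot S"
      using that by (simp add: dot_def)
    have "((\<sigma>, \<tau>'), (\<tau>, \<tau>')) \<in> embL \<Sigma> c"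
      using that by (auto simp: embL_def rel_tensor_def)
    with inS WO have "((\<sigma>, \<tau>'), (\<tau>, \<tau>')) \<in> embR \<Sigma> (hav \<Sigma>) O W"
      by blast
    \<comment> \<open>\<open>embR \<Sigma> (hav \<Sigma>)\<close> fixes the left component \<sigma>
      and moves the right one from \<tau>' to some \<sigma>', where the \<open>W\<close>-step
      starts.\<close>
    then obtain \<sigma>' where "((\<sigma>, \<sigma>'), (\<tau>, \<tau>')) \<in> W"
      by (auto simp: embR_def rel_tensor_def)
    with inS have W: "((\<sigma>, \<sigma>'), (\<tau>, \<tau>')) \<in> W O dot S"
      by blast
    \<comment> \<open>As a sub-identity, the leading factor \<open>dot R\<close> tests the initial
      pair of the step.\<close>
    have "(\<sigma>, \<sigma>') \<in> R"
      using subsetD[OF WC W] by (auto simp: dot_def)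
    moreover have "(\<sigma>', \<tau>') \<in> d"
      using subsetD[OF WU W] by (auto simp: bipair_def embL_def embR_def rel_tensor_def)
    \<comment> \<open>The inclusion \<open>R \<subseteq> \<Sigma> \<times> \<Sigma>\<close> places
      the witness \<sigma>' in the carrier.\<close>
    ultimately show ?thesis
      using R by blast
  qed
  then show ?thesis
    unfolding backward_sim_def by blast
qed

end
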